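(* Let $\mathcal{V}$ be a vector space, $T:\mathcal{V}\to\mathcal{V}$ a linear map, and $N\ge 1$ a natural number. Let $U$ be the operator on $\bigoplus_{k=1}^{N+1}\mathcal{V}$ given by the $(N+1)\times(N+1)$ block matrix $$U=\begin{pmatrix} T & 0 & 0 & \cdots & 0 & I\\ I & 0 & 0 & \cdots & 0 & 0\\ 0 & I & 0 & \cdots & 0 & 0\\ 0 & 0 & I & \cdots & 0 & 0\\ \vdots & \vdots & \vdots & & \vdots & \vdots\\ 0 & 0 & 0 & \cdots & I & 0\end{pmatrix},$$ i.e. $U(x_1,x_2,\dots,x_{N+1})=(Tx_1+x_{N+1},\,x_1,\,x_2,\dots,x_N)$. Then $U$ is invertible on $\bigoplus_{k=1}^{N+1}\mathcal{V}$ and $$T^k=P_{\mathcal{V}}\,(U^k)_{|\mathcal{V}},\qquad \forall k=1,\dots,N,$$ where $\mathcal{V}$ is identified with the first summand $\mathcal{V}\oplus\{0\}\oplus\cdots\oplus\{0\}$ and $P_{\mathcal{V}}:\bigoplus_{k=1}^{N+1}\mathcal{V}\to\bigoplus_{k=1}^{N+1}\mathcal{V}$, $P_{\mathcal{V}}(x_1,\dots,x_{N+1})=(x_1,0,\dots,0)$, is the first coordinate projection; that is, $P_{\mathcal{V}}U^k(x,0,\dots,0)=(T^kx,0,\dots,0)$ for all $x\in\mathcal{V}$ and $1\le k\le N$.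
   Context: Vector spaces are over an arbitrary field. $I$ denotes the identity map of $\mathcal{V}$. *)

theory Defs
  imports Complex_Main "HOL-Library.Function_Algebras"
begin

text \<open>
  The direct sum of \<open>n\<close> copies of \<open>'v\<close> is carried by the functions \<open>nat \<Rightarrow> 'v\<close> vanishing outside
  the index set \<open>{1..n}\<close>.  Addition is the pointwise one of \<open>HOL-Library.Function_Algebras\<close>.
\<close>

definition direct_power :: "nat \<Rightarrow> (nat \<Rightarrow> 'v::ab_group_add) set" where
  "direct_power n = {x. \<forall>i. i \<notin> {1..n} \<longrightarrow> x i = 0}"

definition pointwise_scale :: "('a \<Rightarrow> 'v \<Rightarrow> 'v) \<Rightarrow> 'a \<Rightarrow> (nat \<Rightarrow> 'v) \<Rightarrow> (nat \<Rightarrow> 'v)" where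
  "pointwise_scale scale c x = (\<lambda>i. scale c (x i))"

definition linear_operator_on ::
    "('a \<Rightarrow> 'w \<Rightarrow> 'w) \<Rightarrow> 'w::ab_group_add set \<Rightarrow> ('w \<Rightarrow> 'w) \<Rightarrow> bool" where
  "linear_operator_on scale D F \<longleftrightarrow>
     (\<forall>x\<in>D. F x \<in> D) \<and>
     (\<forall>x\<in>D. \<forall>y\<in>D. F (x + y) = F x + F y) \<and>
     (\<forall>c. \<forall>x\<in>D. F (scale c x) = scale c (F x))"

definition invertible_operator_on ::
    "('a \<Rightarrow> 'w \<Rightarrow> 'w) \<Rightarrow> 'w::ab_group_add set \<Rightarrow> ('w \<Rightarrow> 'w) \<Rightarrow> bool" where
  "invertible_operator_on scale D F \<longleftrightarrow>
     linear_operator_on scale D F \<and>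
     (\<exists>G. linear_operator_on scale D G \<and> (\<forall>x\<in>D. G (F x) = x \<and> F (G x) = x))"

text \<open>The operator with \<open>n \<times> n\<close> block matrix \<open>M\<close>, where \<open>M i j\<close> maps the \<open>j\<close>-th summand to the \<open>i\<close>-th.\<close>

definition block_operator ::
    "nat \<Rightarrow> (nat \<Rightarrow> nat \<Rightarrow> 'v \<Rightarrow> 'v) \<Rightarrow> (nat \<Rightarrow> 'v::ab_group_add) \<Rightarrow> (nat \<Rightarrow> 'v)" where
  "block_operator n M x = (\<lambda>i. if i \<in> {1..n} then \<Sum>j=1..n. M i j (x j) else 0)"

definition U_matrix :: "('v::ab_group_add \<Rightarrow> 'v) \<Rightarrow> nat \<Rightarrow> nat \<Rightarrow> nat \<Rightarrow> 'v \<Rightarrow> 'v" where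
  "U_matrix T N i j =
     (if i = 1 \<and> j = 1 then T
      else if i = 1 \<and> j = N + 1 then id
      else if i = j + 1 then id
      else (\<lambda>_. 0))"

definition U_op :: "('v::ab_group_add \<Rightarrow> 'v) \<Rightarrow> nat \<Rightarrow> (nat \<Rightarrow> 'v) \<Rightarrow> (nat \<Rightarrow> 'v)" where
  "U_op T N = block_operator (N + 1) (U_matrix T N)"

definition first_embed :: "'v::ab_group_add \<Rightarrow> (nat \<Rightarrow> 'v)" where
  "first_embed v = (\<lambda>i. if i = 1 then v else 0)"

definition first_proj :: "(nat \<Rightarrow> 'v::ab_group_add) \<Rightarrow> (nat \<Rightarrow> 'v)" where
  "first_proj x = (\<lambda>i. if i = 1 then x 1 else 0)"

text \<open>Coordinate form: \<open>U (x\<^sub>1, \<dots>, x\<^sub>N\<^sub>+\<^sub>1) = (T x\<^sub>1 + x\<^sub>N\<^sub>+\<^sub>1, x\<^sub>1, \<dots>, x\<^sub>N)\<close>.\<close>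

lemma U_op_apply:
  assumes "N \<ge> 1"
  shows "U_op T N x i =
    (if i = 1 then T (x 1) + x (N + 1) else if i \<in> {2..N + 1} then x (i - 1) else 0)"
proof (cases "i = 1")
  case True
  have "(\<Sum>j=1..N+1. U_matrix T N 1 j (x j)) =
      (\<Sum>j=1..N+1. (if j = 1 then T (x 1) else 0) + (if j = N + 1 then x (N + 1) else 0))"
    using assms by (intro sum.cong) (auto simp: U_matrix_def)
  also have "\<dots> = T (x 1) + x (N + 1)"
    unfolding sum.distrib sum.delta[OF finite_atLeastAtMost] by simp
  finally show ?thesis using True by (simp add: U_op_def block_operator_def)
next
  case False
  show ?thesis
  proof (cases "i \<in> {2..N + 1}")
    case i: True
    have "(\<Sum>j=1..N+1. U_matrix T N i j (x j)) = (\<Sum>j=1..N+1. if j = i - 1 then x (i - 1) else 0)"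
      using i by (intro sum.cong) (auto simp: U_matrix_def)
    also have "\<dots> = x (i - 1)"
      unfolding sum.delta[OF finite_atLeastAtMost] using i by auto
    finally show ?thesis using i by (simp add: U_op_def block_operator_def)
  next
    case i: False
    then show ?thesis using False by (auto simp: U_op_def block_operator_def)
  qed
qed

end

theory Submission imports Defs begin

text \<open>
  Solving \<open>U x = y\<close> from the bottom row upwards gives \<open>x\<^sub>i = y\<^sub>i\<^sub>+\<^sub>1\<close> for \<open>i \<le> N\<close>, and then the first
  row yields \<open>x\<^sub>N\<^sub>+\<^sub>1 = y\<^sub>1 - T y\<^sub>2\<close>.  For the dilation property, \<open>U\<close> shifts the history
  \<open>(T\<^sup>k x, \<dots>, T x, x, 0, \<dots>, 0)\<close> by one and prepends a new iterate; the corner entry \<open>I\<close> contributes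
  nothing as long as the last coordinate is still zero, that is, for the first \<open>N\<close> steps.
\<close>

definition U_inverse :: "('v::ab_group_add \<Rightarrow> 'v) \<Rightarrow> nat \<Rightarrow> (nat \<Rightarrow> 'v) \<Rightarrow> (nat \<Rightarrow> 'v)" where
  "U_inverse T N y =
     (\<lambda>i. if i \<in> {1..N} then y (i + 1) else if i = N + 1 then y 1 - T (y 2) else 0)"

lemma linear_operator_on_U_op:
  assumes "Vector_Spaces.linear scale scale T" and "N \<ge> 1"
  shows "linear_operator_on (pointwise_scale scale) (direct_power (N + 1)) (U_op T N)"
proof -
  interpret T: Vector_Spaces.linear scale scale T by fact
  show ?thesis
    using assms(2)
    by (auto simp: linear_operator_on_def direct_power_def pointwise_scale_def U_op_apply
        fun_eq_iff T.add T.scale T.vs1.scale_right_distrib)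
qed

lemma linear_operator_on_U_inverse:
  assumes "Vector_Spaces.linear scale scale T"
  shows "linear_operator_on (pointwise_scale scale) (direct_power (N + 1)) (U_inverse T N)"
proof -
  interpret T: Vector_Spaces.linear scale scale T by fact
  show ?thesis
    by (auto simp: linear_operator_on_def direct_power_def pointwise_scale_def U_inverse_def
        fun_eq_iff T.add T.scale T.vs1.scale_right_diff_distrib)
qed

text \<open>Outside \<open>{1..N + 1}\<close> both operators return 0, so equality there rests on
  \<open>x\<close> vanishing at those indices.\<close>

lemma U_inverse_U_op:
  assumes "N \<ge> 1" and "x \<in> direct_power (N + 1)"
  shows "U_inverse T N (U_op T N x) = x"
  using assms by (auto simp: direct_power_def U_inverse_def U_op_apply fun_eq_iff)

lemma U_op_U_inverse:
  assumes "N \<ge> 1" and "y \<in> direct_power (N + 1)"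
  shows "U_op T N (U_inverse T N y) = y"
  \<comment> \<open>In the first coordinate, \<open>numeral_2_eq_2\<close> aligns the index
    \<open>1 + 1\<close> with \<open>2\<close>, so the two \<open>T\<close> terms cancel.\<close>
  using assms by (auto simp: direct_power_def U_inverse_def U_op_apply fun_eq_iff numeral_2_eq_2)

text \<open>The whole vector is tracked because each further step also reads its last
  coordinate.\<close>

lemma U_op_power_first_embed:
  assumes "N \<ge> 1" and "k \<le> N"
  shows "(U_op T N ^^ k) (first_embed x) =
    (\<lambda>i. if i \<in> {1..k + 1} then (T ^^ (k + 1 - i)) x else 0)"
  using assms(2)
proof (induction k)
  case 0
  show ?case by (auto simp: first_embed_def)
next
  case (Suc k)
  then have IH: "(U_op T N ^^ k) (first_embed x) =
      (\<lambda>i. if i \<in> {1..k + 1} then (T ^^ (k + 1 - i)) x else 0)" by simp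
  show ?case
    unfolding funpow.simps o_apply IH
  proof
    fix i
    show "U_op T N (\<lambda>i. if i \<in> {1..k + 1} then (T ^^ (k + 1 - i)) x else 0) i =
        (if i \<in> {1..Suc k + 1} then (T ^^ (Suc k + 1 - i)) x else 0)"
      \<comment> \<open>\<open>Suc k \<le> N\<close> puts the index \<open>N + 1\<close> beyond
        \<open>k + 1\<close>, so the corner term is 0.\<close>
      unfolding U_op_apply[OF assms(1)] using Suc.prems by (cases i) auto
  qed
qed

theorem theorem2p8:
  fixes scale :: "'a::field \<Rightarrow> 'v::ab_group_add \<Rightarrow> 'v"
    and T :: "'v \<Rightarrow> 'v"
    and N :: nat
  assumes "vector_space scale"
    and "Vector_Spaces.linear scale scale T"
    and "N \<ge> 1"
  shows "invertible_operator_on (pointwise_scale scale) (direct_power (N + 1)) (U_op T N) \<and>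
    (\<forall>k\<in>{1..N}. \<forall>x. first_proj ((U_op T N ^^ k) (first_embed x)) = first_embed ((T ^^ k) x))"
proof (intro conjI ballI allI)
  show "invertible_operator_on (pointwise_scale scale) (direct_power (N + 1)) (U_op T N)"
    unfolding invertible_operator_on_def
    using linear_operator_on_U_op[OF assms(2,3)] linear_operator_on_U_inverse[OF assms(2)]
      U_inverse_U_op[OF assms(3)] U_op_U_inverse[OF assms(3)] by blast
next
  fix k x
  assume "k \<in> {1..N}"
  then show "first_proj ((U_op T N ^^ k) (first_embed x)) = first_embed ((T ^^ k) x)"
    using assms(3) U_op_power_first_embed[of N k T x]
    by (auto simp: first_proj_def first_embed_def[of "(T ^^ k) x"])
qed

end
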